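(* Let $\epsilon>0$. Suppose $A_1,\ldots,A_m$ are $d\times d$ (complex Hermitian) positive semidefinite matrices satisfying $$\sum_{i=1}^m A_i=\mathbf I\qquad\text{and}\qquad \operatorname{Tr}(A_i)\le\epsilon\quad\text{for all } i=1,\ldots,m.$$ Then all roots of the mixed characteristic polynomial $\mu[A_1,\ldots,A_m]$ are real and the largest root is at most $(1+\sqrt\epsilon)^2$.
   Context: $\mathbf I$ is the $d\times d$ identity matrix. For $d\times d$ complex matrices $A_1,\ldots,A_m$, the mixed characteristic polynomial is the polynomial in $z$ defined by $$\mu[A_1,\ldots,A_m](z)=\Big(\prod_{i=1}^m(1-\partial_{z_i})\Big)\det\Big(z\mathbf I+\sum_{i=1}^m z_iA_i\Big)\Big|_{z_1=\cdots=z_m=0},\qquad z\in\mathbb C.$$ *)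

theory Defs
  imports "HOL-Analysis.Analysis"
begin

definition hermitian :: "complex^'n^'n \<Rightarrow> bool" where
  "hermitian A \<longleftrightarrow> (\<forall>r s. A $ r $ s = cnj (A $ s $ r))"

text \<open>The quadratic form of a Hermitian matrix is real-valued, so taking its real part loses nothing.\<close>

definition pos_semidef :: "complex^'n^'n \<Rightarrow> bool" where
  "pos_semidef A \<longleftrightarrow>
     hermitian A \<and> (\<forall>v :: complex^'n. 0 \<le> Re (\<Sum>r\<in>UNIV. cnj (v $ r) * (A *v v) $ r))"

text \<open>Functions of the variables \<open>z\<^sub>1, z\<^sub>2, \<dots>\<close> are functions of a sequence \<open>nat \<Rightarrow> complex\<close>;
  \<open>partial_deriv i\<close> differentiates in the \<open>i\<close>-th variable with the others fixed.\<close>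

definition partial_deriv ::
  "nat \<Rightarrow> ((nat \<Rightarrow> complex) \<Rightarrow> complex) \<Rightarrow> (nat \<Rightarrow> complex) \<Rightarrow> complex" where
  "partial_deriv i f z = deriv (\<lambda>w. f (z(i := w))) (z i)"

definition one_minus_partial ::
  "nat \<Rightarrow> ((nat \<Rightarrow> complex) \<Rightarrow> complex) \<Rightarrow> (nat \<Rightarrow> complex) \<Rightarrow> complex" where
  "one_minus_partial i f = (\<lambda>z. f z - partial_deriv i f z)"

text \<open>The product of the operators is their composition; they are applied here to a polynomial
  function, on which they commute, so the order of composition is immaterial.
  The matrix \<open>mat z\<close> is \<open>z\<close> times the identity.\<close>

definition mixed_char_poly :: "nat \<Rightarrow> (nat \<Rightarrow> complex^'n^'n) \<Rightarrow> complex \<Rightarrow> complex" where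
  "mixed_char_poly m A z =
     foldr one_minus_partial [1..<Suc m]
       (\<lambda>x. det (mat z + (\<Sum>i=1..m. \<chi> r s. x i * A i $ r $ s))) (\<lambda>_. 0)"

end

(* With z \<in> C^m restricted to coordinates that lie in the upper half-plane or on a ray [a_i, \<infinity>),
   the pencil determinant det (\<Sum> z_i A_i) does not vanish, and neither does its image under each
   1 - \<partial>_i once the i-th ray is shortened by \<delta>; at the end one restricts to the diagonal.
   The shift is controlled by the barrier functions of Marcus, Spielman and Srivastava,
   \<Phi>_j = \<partial>_j f / f.  Being a log-derivative of a stable polynomial, -\<Phi>_j is a Pick function of
   each variable.  This replaces the usual root-interlacing or Helton-Vinnikov arguments:
   monotonicity of \<Phi>_j is the sign of the derivative of a Pick function on the axis, the convexity
   estimate is the Schwarz-Pick inequality in a slit plane, and complex zeros of f - \<partial>_i f are moved to real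
   points by the open mapping theorem. *)
theory Submission
  imports Defs "HOL-Complex_Analysis.Conformal_Mappings"
    "HOL-Computational_Algebra.Fundamental_Theorem_Algebra"
begin

section \<open>Polynomial functions of countably many variables\<close>

text \<open>Polynomials as a rule-generated class of functions: facts about slices, dependence on
  variables and derivatives follow by induction on the rules.\<close>

inductive poly_fun :: "((nat \<Rightarrow> complex) \<Rightarrow> complex) \<Rightarrow> bool" where
  const: "poly_fun (\<lambda>z. c)"
| coord: "poly_fun (\<lambda>z. z k)"
| add: "poly_fun f \<Longrightarrow> poly_fun g \<Longrightarrow> poly_fun (\<lambda>z. f z + g z)"
| mult: "poly_fun f \<Longrightarrow> poly_fun g \<Longrightarrow> poly_fun (\<lambda>z. f z * g z)"

lemma poly_fun_diff:
  assumes "poly_fun f" "poly_fun g"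
  shows "poly_fun (\<lambda>z. f z - g z)"
  using poly_fun.add[OF assms(1) poly_fun.mult[OF poly_fun.const[of "-1"] assms(2)]] by simp

lemma poly_fun_sum: "(\<And>i. i \<in> I \<Longrightarrow> poly_fun (f i)) \<Longrightarrow> poly_fun (\<lambda>z. \<Sum>i\<in>I. f i z)"
  by (induction I rule: infinite_finite_induct) (auto intro: poly_fun.intros)

lemma poly_fun_prod: "(\<And>i. i \<in> I \<Longrightarrow> poly_fun (f i)) \<Longrightarrow> poly_fun (\<lambda>z. \<Prod>i\<in>I. f i z)"
  by (induction I rule: infinite_finite_induct) (auto intro: poly_fun.intros)

text \<open>Passes to a univariate \<open>poly\<close>, where derivatives, roots and factorization
  are available.\<close>

lemma poly_fun_slice:
  assumes "poly_fun f"
  obtains p where "\<And>w. f (z(i := w)) = poly p w"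
proof -
  have "\<exists>p. \<forall>w. f (z(i := w)) = poly p w"
    using assms
  proof induction
    case (const c)
    show ?case by (rule exI[of _ "[:c:]"]) simp
  next
    case (coord k)
    show ?case by (rule exI[of _ "if k = i then [:0, 1:] else [:z k:]"]) simp
  next
    case (add f g)
    then show ?case by (metis poly_add)
  next
    case (mult f g)
    then show ?case by (metis poly_mult)
  qed
  then show ?thesis by (elim exE) (rule that, erule spec)
qed

text \<open>A point has infinitely many coordinates; this lets arguments that alter them one at a
  time stop after finitely many.\<close>

lemma poly_fun_finite_support:
  assumes "poly_fun f"
  obtains I where "finite I" "\<And>z z'. (\<And>i. i \<in> I \<Longrightarrow> z i = z' i) \<Longrightarrow> f z = f z'"
proof -
  have "\<exists>I. finite I \<and> (\<forall>z z'. (\<forall>i\<in>I. z i = z' i) \<longrightarrow> f z = f z')"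
    using assms
  proof induction
    case (coord k)
    show ?case by (rule exI[of _ "{k}"]) simp
  next
    case (add f g)
    then obtain I J where "finite I" "\<forall>z z'. (\<forall>i\<in>I. z i = z' i) \<longrightarrow> f z = f z'"
      "finite J" "\<forall>z z'. (\<forall>i\<in>J. z i = z' i) \<longrightarrow> g z = g z'" by blast
    then show ?case by (intro exI[of _ "I \<union> J"] conjI) (simp, metis UnCI)
  next
    case (mult f g)
    then obtain I J where "finite I" "\<forall>z z'. (\<forall>i\<in>I. z i = z' i) \<longrightarrow> f z = f z'"
      "finite J" "\<forall>z z'. (\<forall>i\<in>J. z i = z' i) \<longrightarrow> g z = g z'" by blast
    then show ?case by (intro exI[of _ "I \<union> J"] conjI) (simp, metis UnCI)
  qed auto
  then show ?thesis by (elim exE conjE) (rule that, assumption, metis)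
qed

section \<open>Calculus of partial derivatives\<close>

lemma partial_deriv_slice:
  assumes "\<And>w. f (z(i := w)) = poly p w"
  shows "partial_deriv i f (z(i := w)) = poly (pderiv p) w"
  unfolding partial_deriv_def using assms by (simp add: poly_DERIV DERIV_imp_deriv)

lemma has_partial_deriv:
  assumes "poly_fun f"
  shows "((\<lambda>w. f (z(i := w))) has_field_derivative partial_deriv i f (z(i := w))) (at w)"
proof -
  obtain p where p: "\<And>w. f (z(i := w)) = poly p w" using poly_fun_slice[OF assms] by blast
  show ?thesis
    unfolding partial_deriv_slice[where f = f, OF p] p by (rule poly_DERIV)
qed

lemma partial_deriv_eqI:
  assumes "((\<lambda>w. f (z(i := w))) has_field_derivative D) (at (z i))"
  shows "partial_deriv i f z = D"
  unfolding partial_deriv_def using assms by (rule DERIV_imp_deriv)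

lemma has_partial_deriv_at:
  "poly_fun f \<Longrightarrow> ((\<lambda>w. f (z(i := w))) has_field_derivative partial_deriv i f z) (at (z i))"
  using has_partial_deriv[of f z i "z i"] by simp

lemma partial_deriv_const: "partial_deriv i (\<lambda>z. c) = (\<lambda>z. 0)"
  by (rule ext, rule partial_deriv_eqI) auto

lemma partial_deriv_coord: "partial_deriv i (\<lambda>z. z k) = (\<lambda>z. if k = i then 1 else 0)"
  by (rule ext, rule partial_deriv_eqI) (auto intro!: derivative_eq_intros)

lemma partial_deriv_add:
  assumes "poly_fun f" "poly_fun g"
  shows "partial_deriv i (\<lambda>z. f z + g z) = (\<lambda>z. partial_deriv i f z + partial_deriv i g z)"
  using assms by (intro ext partial_deriv_eqI DERIV_add has_partial_deriv_at)

lemma partial_deriv_diff: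
  assumes "poly_fun f" "poly_fun g"
  shows "partial_deriv i (\<lambda>z. f z - g z) = (\<lambda>z. partial_deriv i f z - partial_deriv i g z)"
  using assms by (intro ext partial_deriv_eqI DERIV_diff has_partial_deriv_at)

lemma partial_deriv_mult:
  assumes "poly_fun f" "poly_fun g"
  shows "partial_deriv i (\<lambda>z. f z * g z) =
    (\<lambda>z. partial_deriv i f z * g z + partial_deriv i g z * f z)"
proof (intro ext partial_deriv_eqI)
  fix z
  show "((\<lambda>w. f (z(i := w)) * g (z(i := w))) has_field_derivative
      partial_deriv i f z * g z + partial_deriv i g z * f z) (at (z i))"
    using DERIV_mult[OF has_partial_deriv_at[OF assms(1)] has_partial_deriv_at[OF assms(2)], of z i z]
    by simp
qed

lemma poly_fun_partial_deriv: "poly_fun f \<Longrightarrow> poly_fun (partial_deriv i f)"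
  by (induction rule: poly_fun.induct)
    (auto simp: partial_deriv_const partial_deriv_coord partial_deriv_add partial_deriv_mult
      intro: poly_fun.intros)

text \<open>Used to identify the \<open>j\<close>-derivative of \<open>partial_deriv i f\<close>
  with the \<open>i\<close>-derivative of \<open>partial_deriv j f\<close> when a barrier is
  differentiated.\<close>

lemma partial_deriv_commute:
  "poly_fun f \<Longrightarrow> partial_deriv i (partial_deriv j f) = partial_deriv j (partial_deriv i f)"
proof (induction rule: poly_fun.induct)
  case (mult f g)
  note [simp] = partial_deriv_add partial_deriv_mult poly_fun_partial_deriv poly_fun.mult
  show ?case
    using mult.hyps by simp (subst mult.IH(1), subst mult.IH(2), simp add: algebra_simps)
next
  case (add f g)
  note [simp] = partial_deriv_add poly_fun_partial_deriv
  show ?case using add.hyps by simp (subst add.IH(1), subst add.IH(2), rule refl)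
qed (simp_all add: partial_deriv_const partial_deriv_coord)

lemma poly_fun_one_minus_partial: "poly_fun f \<Longrightarrow> poly_fun (one_minus_partial i f)"
  unfolding one_minus_partial_def by (intro poly_fun_diff poly_fun_partial_deriv)

text \<open>For a polynomial this says that the coefficients are real. It makes values at real
  points real and reflects the upper half-plane to the lower one.\<close>

definition real_fun :: "((nat \<Rightarrow> complex) \<Rightarrow> complex) \<Rightarrow> bool" where
  "real_fun f \<longleftrightarrow> (\<forall>z. f (\<lambda>i. cnj (z i)) = cnj (f z))"

lemma real_fun_partial_deriv:
  assumes "poly_fun f" "real_fun f"
  shows "real_fun (partial_deriv i f)"
  unfolding real_fun_def
proof (intro allI partial_deriv_eqI)
  fix z
  have upd: "(\<lambda>k. cnj (z k))(i := w) = (\<lambda>k. cnj ((z(i := cnj w)) k))" for w by auto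
  have eq: "f ((\<lambda>k. cnj (z k))(i := w)) = (cnj \<circ> (\<lambda>w. f (z(i := w))) \<circ> cnj) w" for w
    unfolding upd by (simp only: o_def assms(2)[unfolded real_fun_def, rule_format])
  show "((\<lambda>w. f ((\<lambda>k. cnj (z k))(i := w))) has_field_derivative cnj (partial_deriv i f z))
      (at (cnj (z i)))"
    unfolding eq using has_partial_deriv_at[OF assms(1), of z i]
    by (intro has_field_derivative_cnj_cnj) simp
qed

lemma real_fun_one_minus_partial:
  "poly_fun f \<Longrightarrow> real_fun f \<Longrightarrow> real_fun (one_minus_partial i f)"
  using real_fun_partial_deriv[of f i] by (simp add: real_fun_def one_minus_partial_def)

lemma real_fun_real_point:
  assumes "real_fun f" "\<And>i. Im (z i) = 0"
  shows "Im (f z) = 0"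
proof -
  have "(\<lambda>i. cnj (z i)) = z" using assms(2) by (auto simp: complex_eq_iff)
  then have "f z = cnj (f z)" using assms(1) by (metis real_fun_def)
  then show ?thesis by (metis complex_cnj_cancel_iff Reals_cnj_iff complex_is_Real_iff)
qed

text \<open>The log-derivative is the sum of \<open>1 / (z - r)\<close> over the roots
  \<open>r\<close>, and each \<open>z - r\<close> lies in the closed upper half-plane. The induction
  splits off one root at a time.\<close>

lemma Im_log_deriv_nonpos:
  fixes p :: "complex poly"
  assumes "\<And>r. poly p r = 0 \<Longrightarrow> Im r \<le> 0" "poly p z \<noteq> 0" "Im z \<ge> 0"
  shows "Im (poly (pderiv p) z / poly p z) \<le> 0"
  using assms
proof (induction "degree p" arbitrary: p)
  case 0
  then show ?case by (metis pderiv_eq_0_iff poly_0 div_0 zero_complex.simps(2) order_refl)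
next
  case (Suc n)
  then have "\<not> constant (poly p)" by (simp add: constant_degree)
  then obtain r where r: "poly p r = 0" using fundamental_theorem_of_algebra by blast
  then obtain q where q: "p = [:- r, 1:] * q" by (metis poly_eq_0_iff_dvd dvd_def)
  then have q0: "q \<noteq> 0" using Suc.prems(2) by auto
  have "degree q = n" using Suc.hyps(2) q0 unfolding q by (subst (asm) degree_mult_eq) auto
  then have IH: "Im (poly (pderiv q) z / poly q z) \<le> 0"
    using Suc.hyps(1)[of q] Suc.prems q by auto
  have nz: "z - r \<noteq> 0" "poly q z \<noteq> 0" using Suc.prems(2) q by auto
  have "pderiv p = q + [:- r, 1:] * pderiv q"
    unfolding q pderiv_mult by (simp add: pderiv_pCons)
  then have "poly (pderiv p) z / poly p z = 1 / (z - r) + poly (pderiv q) z / poly q z"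
    using nz by (simp add: \<open>pderiv p = _\<close> poly_mult q add_divide_distrib del: mult_pCons_left)
  moreover have "Im (1 / (z - r)) \<le> 0"
    using Suc.prems(1)[OF r] Suc.prems(3) by (simp add: Im_divide divide_nonpos_nonneg)
  ultimately show ?case using IH by simp
qed

section \<open>Pick functions\<close>

text \<open>A nonconstant \<open>h\<close> is open, so its image would contain a ball around the
  real value \<open>h w0\<close> and thus points with positive imaginary part.\<close>

lemma halfplane_constant:
  assumes holo: "h holomorphic_on {w. Im w > 0}"
    and low: "\<And>w. Im w > 0 \<Longrightarrow> Im (h w) \<le> 0"
    and w0: "Im w0 > 0" "Im (h w0) = 0" and w: "Im w > 0"
  shows "h w = h w0"
proof (rule ccontr)
  assume "h w \<noteq> h w0"
  then have nc: "\<not> h constant_on {w. Im w > 0}"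
    unfolding constant_on_def using w w0(1) by auto
  have op: "open {w. Im w > 0}" by (rule open_halfspace_Im_gt)
  have "open (h ` {w. Im w > 0})"
    by (rule open_mapping_thm[OF holo op _ op subset_refl nc])
      (rule convex_connected[OF convex_halfspace_Im_gt])
  then obtain e where e: "e > 0" "ball (h w0) e \<subseteq> h ` {w. Im w > 0}"
    using w0(1) by (metis openE image_eqI mem_Collect_eq)
  have "h w0 + \<i> * of_real (e / 2) \<in> ball (h w0) e"
    using e(1) by (simp add: dist_norm norm_mult)
  then obtain v where "Im v > 0" "h v = h w0 + \<i> * of_real (e / 2)" using e(2) by auto
  then show False using low[of v] w0(2) e(1) by simp
qed

text \<open>Along the vertical approach \<open>b + \<i> * y\<close> the difference quotient has real
  part \<open>Im (u (b + \<i> * y)) / y\<close>.\<close>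

lemma halfplane_Re_deriv_nonneg:
  assumes D: "(u has_field_derivative D) (at (of_real b))"
    and up: "\<And>w. Im w > 0 \<Longrightarrow> Im (u w) \<ge> 0" and b: "Im (u (of_real b)) = 0"
  shows "Re D \<ge> 0"
proof -
  have 1: "((\<lambda>h. (u (of_real b + h) - u (of_real b)) / h) \<longlongrightarrow> D) (at 0)"
    using D by (simp add: DERIV_def)
  have 2: "filterlim (\<lambda>y. \<i> * of_real y) (at 0) (at_right (0::real))"
  proof (rule filterlim_atI)
    show "((\<lambda>y. \<i> * of_real y) \<longlongrightarrow> 0) (at_right (0::real))"
      by (auto intro!: tendsto_eq_intros)
    show "\<forall>\<^sub>F y in at_right (0::real). \<i> * of_real y \<noteq> 0"
      by (rule eventually_at_right_less[THEN eventually_mono]) auto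
  qed
  have 3: "((\<lambda>y. Re ((u (of_real b + \<i> * of_real y) - u (of_real b)) / (\<i> * of_real y)))
      \<longlongrightarrow> Re D) (at_right (0::real))"
    by (intro tendsto_Re filterlim_compose[OF 1 2])
  have 4: "\<forall>\<^sub>F y in at_right (0::real).
      0 \<le> Re ((u (of_real b + \<i> * of_real y) - u (of_real b)) / (\<i> * of_real y))"
  proof (rule eventually_at_right_less[THEN eventually_mono])
    fix y :: real
    assume y: "0 < y"
    have "Im (u (of_real b + \<i> * of_real y)) \<ge> 0" by (rule up) (use y in simp)
    then show "0 \<le> Re ((u (of_real b + \<i> * of_real y) - u (of_real b)) / (\<i> * of_real y))"
      using b y by (simp add: Re_divide)
  qed
  show ?thesis by (rule tendsto_lowerbound[OF 3 4]) simp
qed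

lemma Re_csqrt_pos:
  assumes "z \<notin> \<real>\<^sub>\<le>\<^sub>0"
  shows "Re (csqrt z) > 0"
proof (rule ccontr)
  assume "\<not> Re (csqrt z) > 0"
  then have "Re (csqrt z) = 0" using csqrt_principal[of z] by auto
  then have "(csqrt z)\<^sup>2 = - of_real ((Im (csqrt z))\<^sup>2)"
    by (simp add: complex_eq_iff power2_eq_square del: csqrt.simps power2_csqrt)
  then have "z = - of_real ((Im (csqrt z))\<^sup>2)" by simp
  then show False using assms
    by (metis complex_nonpos_Reals_iff Re_complex_of_real Im_complex_of_real neg_le_0_iff_le
        of_real_minus zero_le_power2)
qed

text \<open>The sign conditions keep \<open>u\<close> off the nonpositive axis, so \<open>u\<close>
  maps one slit plane into another. The estimate compares their hyperbolic metrics at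
  \<open>b\<close>, with equality for \<open>u w = w - a\<close>.\<close>

lemma Schwarz_Pick_slit_plane:
  assumes holo: "u holomorphic_on {w. \<not> (Im w = 0 \<and> Re w \<le> a)}"
    and up: "\<And>w. Im w > 0 \<Longrightarrow> Im (u w) > 0"
    and down: "\<And>w. Im w < 0 \<Longrightarrow> Im (u w) < 0"
    and pos: "\<And>x. x > a \<Longrightarrow> Im (u (of_real x)) = 0 \<and> Re (u (of_real x)) > 0"
    and b: "b > a"
  shows "Re (deriv u (of_real b)) \<le> Re (u (of_real b)) / (b - a)"
proof -
  define S where "S = {w. \<not> (Im w = 0 \<and> Re w \<le> a)}"
  have "S = - {w. Im w = 0 \<and> Re w \<le> a}" by (auto simp: S_def)
  moreover have "closed {w. Im w = 0 \<and> Re w \<le> a}"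
    by (intro closed_Collect_conj closed_Collect_eq closed_Collect_le continuous_intros)
  ultimately have "open S" by (simp add: open_Compl)
  have nonpos: "u w \<notin> \<real>\<^sub>\<le>\<^sub>0" if "w \<in> S" for w
  proof (cases "Im w = 0")
    case True
    then have "Re w > a" "w = of_real (Re w)" using that by (auto simp: S_def complex_eq_iff)
    then show ?thesis using pos[of "Re w"] by (auto simp: complex_nonpos_Reals_iff)
  next
    case False
    then show ?thesis using up[of w] down[of w] by (fastforce simp: complex_nonpos_Reals_iff)
  qed
  define v0 where "v0 = sqrt (Re (u (of_real b)))"
  have v0: "v0 > 0" "v0\<^sup>2 = Re (u (of_real b))" using pos[OF b] by (auto simp: v0_def)
  have csb: "csqrt (u (of_real b)) = of_real v0"
  proof -
    have "u (of_real b) = of_real (Re (u (of_real b)))" using pos[OF b] by (simp add: complex_eq_iff)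
    then show ?thesis using pos[OF b] unfolding v0_def
      by (metis csqrt_of_real_nonneg less_eq_real_def Im_complex_of_real Re_complex_of_real)
  qed
  \<comment> \<open>\<open>\<zeta> \<mapsto> sqrt (u (a + \<zeta>\<^sup>2))\<close> preserves the right half-plane; conjugated with Cayley maps it
    becomes the self-map \<open>h\<close> of the disc, to which the Schwarz lemma applies.\<close>
  define g where "g s = of_real a + of_real (b - a) * ((1 + s) / (1 - s))\<^sup>2" for s :: complex
  define h where "h s = (csqrt (u (g s)) - of_real v0) / (csqrt (u (g s)) + of_real v0)" for s
  have gS: "g s \<in> S" if s: "norm s < 1" for s
  proof -
    define k where "k = (1 + s) / (1 - s)"
    have s1: "1 - s \<noteq> 0" using s by auto
    have "(norm s)\<^sup>2 < 1" using s by (simp add: power_less_one_iff abs_square_less_1)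
    then have n1: "(Re s)\<^sup>2 + (Im s)\<^sup>2 < 1" by (simp add: cmod_power2)
    have "(Re (1 - s))\<^sup>2 + (Im (1 - s))\<^sup>2 > 0"
      using s1 by (metis complex_neq_0)
    \<comment> \<open>The numerator of \<open>Re k\<close> is \<open>1 - (norm s)\<^sup>2\<close>; a
      square of a point with positive real part misses the nonpositive axis.\<close>
    then have Rek: "Re k > 0"
      using n1 unfolding k_def Re_divide
      by (intro divide_pos_pos) (auto simp: power2_eq_square algebra_simps)
    have "\<not> (Im (k\<^sup>2) = 0 \<and> Re (k\<^sup>2) \<le> 0)"
      using Rek by (auto simp: power2_eq_square mult_le_0_iff)
    then show ?thesis
      using b unfolding S_def g_def k_def[symmetric]
      by (auto simp: mult_le_0_iff)
  qed
  have holg: "g holomorphic_on ball 0 1"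
    unfolding g_def by (intro holomorphic_intros) auto
  have holu: "(\<lambda>s. csqrt (u (g s))) holomorphic_on ball 0 1"
  proof (intro holomorphic_intros)
    have "g ` ball 0 1 \<subseteq> S" using gS by auto
    then show "(\<lambda>s. u (g s)) holomorphic_on ball 0 1"
      using holomorphic_on_compose_gen[OF holg holo[folded S_def]] by (simp add: o_def)
  qed (use gS nonpos in auto)
  have Repos: "Re (csqrt (u (g s))) > 0" if "norm s < 1" for s
    by (rule Re_csqrt_pos[OF nonpos[OF gS[OF that]]])
  have nz: "csqrt (u (g s)) + of_real v0 \<noteq> 0" if "norm s < 1" for s
    using Repos[OF that] v0(1)
    by (metis Re_complex_of_real add_pos_pos less_irrefl plus_complex.sel(1) zero_complex.sel(1))
  have holh: "h holomorphic_on ball 0 1"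
    unfolding h_def using nz by (intro holomorphic_intros holu) auto
  have h0: "h 0 = 0" by (simp add: h_def g_def csb del: csqrt.simps)
  have h1: "norm (h s) < 1" if "norm s < 1" for s
  proof -
    define v where "v = csqrt (u (g s))"
    \<comment> \<open>A point of the right half-plane is closer to \<open>v0\<close> than to
      \<open>- v0\<close>.\<close>
    have "(norm (v - of_real v0))\<^sup>2 < (norm (v + of_real v0))\<^sup>2"
      using Repos[OF that] v0(1) unfolding v_def[symmetric] cmod_power2
      by (simp add: power2_eq_square algebra_simps)
    then have "norm (v - of_real v0) < norm (v + of_real v0)"
      by (rule power2_less_imp_less) simp
    then show ?thesis
      unfolding h_def v_def[symmetric] norm_divide
      by (subst divide_less_eq_1_pos) (auto intro: order.strict_trans1[OF norm_ge_zero])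
  qed
  define c where "c = deriv u (of_real b)"
  have bS: "of_real b \<in> S" using b by (simp add: S_def)
  have du: "(u has_field_derivative c) (at (g 0))"
    using holomorphic_derivI[OF holo[folded S_def] \<open>open S\<close> bS] by (simp add: c_def g_def)
  \<comment> \<open>At 0 the Cayley map has value 1 and derivative 2, so its square has derivative
    4.\<close>
  have dg: "(g has_field_derivative of_real (4 * (b - a))) (at 0)"
    unfolding g_def by (auto intro!: derivative_eq_intros)
  have dcs: "(csqrt has_field_derivative 1 / (2 * of_real v0)) (at (u (g 0)))"
    using has_field_derivative_csqrt[OF nonpos[OF gS[of 0]]]
    by (simp add: g_def csb inverse_eq_divide del: csqrt.simps)
  have dv: "((\<lambda>s. csqrt (u (g s))) has_field_derivative
      1 / (2 * of_real v0) * (c * of_real (4 * (b - a)))) (at 0)"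
    using DERIV_chain2[OF dcs DERIV_chain2[OF du dg]] .
  \<comment> \<open>The outer Cayley map has derivative \<open>1 / (2 * v0)\<close> at
    \<open>v0\<close>, which multiplies the derivative in \<open>dv\<close>.\<close>
  have "(h has_field_derivative c * of_real (b - a) / (of_real v0)\<^sup>2) (at 0)"
    unfolding h_def
  proof (rule DERIV_cong[OF DERIV_divide[OF DERIV_diff[OF dv DERIV_const] DERIV_add[OF dv DERIV_const]]])
    show "csqrt (u (g 0)) + of_real v0 \<noteq> 0" using nz[of 0] by simp
  qed (use v0(1) in \<open>simp add: g_def csb field_simps power2_eq_square del: csqrt.simps\<close>)
  then have "norm (c * of_real (b - a) / (of_real v0)\<^sup>2) \<le> 1"
    using Schwarz_Lemma(2)[OF holh h0 h1, of 0] by (simp add: DERIV_imp_deriv)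
  then have "norm c * (b - a) \<le> v0\<^sup>2"
    using v0(1) b by (simp add: norm_divide norm_mult norm_power divide_le_eq_1 flip: of_real_diff)
  moreover have "Re c * (b - a) \<le> norm c * (b - a)"
    using b by (intro mult_right_mono complex_Re_le_cmod) auto
  ultimately have "Re c * (b - a) \<le> Re (u (of_real b))" using v0(2) by linarith
  then show ?thesis using b by (simp add: c_def pos_le_divide_eq)
qed

text \<open>Here \<open>- G\<close> is a Pick function, real on the ray. Vertical difference
  quotients give the sign of the derivative, hence monotonicity. The last claim is the tangent
  inequality at \<open>y\<close> that convexity would give; it comes from Schwarz-Pick on the plane
  slit up to \<open>x\<close>.\<close>

lemma
  assumes diff: "\<And>w. Im w \<noteq> 0 \<or> a \<le> Re w \<Longrightarrow> G field_differentiable at w"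
    and up: "\<And>w. Im w > 0 \<Longrightarrow> Im (G w) \<le> 0"
    and down: "\<And>w. Im w < 0 \<Longrightarrow> Im (G w) \<ge> 0"
    and real: "\<And>x. x \<ge> a \<Longrightarrow> Im (G (of_real x)) = 0"
  shows halfplane_deriv_nonpos: "a \<le> x \<Longrightarrow> Re (deriv G (of_real x)) \<le> 0"
    and halfplane_antimono: "a \<le> x \<Longrightarrow> x \<le> y \<Longrightarrow> Re (G (of_real y)) \<le> Re (G (of_real x))"
    and halfplane_tangent: "a \<le> x \<Longrightarrow> x < y \<Longrightarrow>
      - ((y - x) * Re (deriv G (of_real y))) \<le> Re (G (of_real x)) - Re (G (of_real y))"
proof -
  have dG: "(G has_field_derivative deriv G w) (at w)" if "Im w \<noteq> 0 \<or> a \<le> Re w" for w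
    using diff[OF that] by (simp add: field_differentiable_derivI)
  show nonpos: "Re (deriv G (of_real x)) \<le> 0" if "a \<le> x" for x
    using halfplane_Re_deriv_nonneg[of "\<lambda>w. - G w" "- deriv G (of_real x)" x]
      DERIV_minus[OF dG[of "of_real x"]] that up real by auto
  show anti: "Re (G (of_real y)) \<le> Re (G (of_real x))" if "a \<le> x" "x \<le> y" for x y
  proof (rule DERIV_nonpos_imp_nonincreasing[OF that(2)])
    fix t assume "x \<le> t" "t \<le> y"
    then have t: "a \<le> t" using that by simp
    have "((\<lambda>t. Re (G (of_real t))) has_vector_derivative Re (deriv G (of_real t))) (at t)"
      by (intro bounded_linear.has_vector_derivative[OF bounded_linear_Re]
          has_vector_derivative_real_field dG) (use t in simp)
    then show "\<exists>y. ((\<lambda>t. Re (G (of_real t))) has_real_derivative y) (at t) \<and> y \<le> 0"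
      using nonpos[OF t] by (auto simp: has_real_derivative_iff_has_vector_derivative)
  qed
  assume xy: "a \<le> x" "x < y"
  \<comment> \<open>The summand \<open>w - x\<close> only makes the inequalities for \<open>u\<close> strict; its contributions to the two
    sides of the Schwarz-Pick estimate cancel.\<close>
  define u where "u w = of_real (Re (G (of_real x))) - G w + (w - of_real x)" for w
  have "Re (deriv u (of_real y)) \<le> Re (u (of_real y)) / (y - x)"
  proof (rule Schwarz_Pick_slit_plane[OF _ _ _ _ xy(2)])
    have "u field_differentiable at w" if "\<not> (Im w = 0 \<and> Re w \<le> x)" for w
      unfolding u_def using that xy(1)
      by (intro field_differentiable_add field_differentiable_diff field_differentiable_const
          field_differentiable_ident diff) auto
    then show "u holomorphic_on {w. \<not> (Im w = 0 \<and> Re w \<le> x)}"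
      by (auto simp: holomorphic_on_def intro: field_differentiable_at_within)
    show "Im (u w) > 0" if "Im w > 0" for w using up[OF that] that by (simp add: u_def)
    show "Im (u w) < 0" if "Im w < 0" for w using down[OF that] that by (simp add: u_def)
    show "Im (u (of_real t)) = 0 \<and> Re (u (of_real t)) > 0" if "x < t" for t
      using anti[of x t] real[of t] that xy(1) by (simp add: u_def)
  qed
  moreover have "deriv u (of_real y) = 1 - deriv G (of_real y)"
    unfolding u_def using xy
    by (intro DERIV_imp_deriv) (auto intro!: derivative_eq_intros dG)
  ultimately show "- ((y - x) * Re (deriv G (of_real y))) \<le> Re (G (of_real x)) - Re (G (of_real y))"
    using xy by (simp add: u_def field_simps)
qed

section \<open>Stability and barriers\<close>

text \<open>Joins stability (all coordinates in the upper half-plane) with absence of zeros in the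
  real orthant above \<open>a\<close>. Mixed points are included so that coordinates can be moved to
  the real axis one by one.\<close>

definition stable_above :: "((nat \<Rightarrow> complex) \<Rightarrow> complex) \<Rightarrow> (nat \<Rightarrow> real) \<Rightarrow> bool" where
  "stable_above f a \<longleftrightarrow> (\<forall>z. (\<forall>i. Im (z i) > 0 \<or> Im (z i) = 0 \<and> a i \<le> Re (z i)) \<longrightarrow> f z \<noteq> 0)"

abbreviation cpt :: "(nat \<Rightarrow> real) \<Rightarrow> nat \<Rightarrow> complex" where
  "cpt x \<equiv> \<lambda>i. of_real (x i)"

text \<open>With the other coordinates fixed, the slice in variable \<open>i\<close> has all its
  roots in the closed lower half-plane.\<close>

lemma stable_above_Im_log_deriv:
  assumes f: "poly_fun f" "stable_above f a"
    and z: "\<And>k. Im (z k) > 0 \<or> Im (z k) = 0 \<and> a k \<le> Re (z k)"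
  shows "Im (partial_deriv i f z / f z) \<le> 0"
proof -
  obtain p where p: "\<And>w. f (z(i := w)) = poly p w" using poly_fun_slice[OF f(1)] by blast
  have nz: "poly p w \<noteq> 0" if "Im w > 0 \<or> Im w = 0 \<and> a i \<le> Re w" for w
    using f(2) z that unfolding stable_above_def p[symmetric] by auto
  have "Im (poly (pderiv p) (z i) / poly p (z i)) \<le> 0"
    using nz z[of i] by (intro Im_log_deriv_nonpos) (force simp: not_less[symmetric])+
  then show ?thesis
    using p[of "z i"] partial_deriv_slice[where f = f, OF p, of "z i"] by simp
qed

text \<open>As a function of \<open>z\<^sub>j\<close> the log-derivative maps the upper half-plane to the closed lower one, so
  if it takes the value 1 there it is constant.\<close>

lemma zero_move_coordinate:
  assumes f: "poly_fun f" "stable_above f a" and aa': "\<And>k. a k \<le> a' k"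
    and z: "\<And>k. Im (z k) > 0 \<or> Im (z k) = 0 \<and> a' k \<le> Re (z k)"
    and zero: "one_minus_partial i f z = 0" and j: "Im (z j) > 0"
  shows "one_minus_partial i f (z(j := w)) = 0"
proof -
  obtain p where p: "\<And>w. f (z(j := w)) = poly p w" using poly_fun_slice[OF f(1)] by blast
  obtain q where q: "\<And>w. partial_deriv i f (z(j := w)) = poly q w"
    using poly_fun_slice[OF poly_fun_partial_deriv[OF f(1)]] by blast
  have pt: "Im ((z(j := w)) k) > 0 \<or> Im ((z(j := w)) k) = 0 \<and> a k \<le> Re ((z(j := w)) k)"
    if "Im w > 0" for w k
    using z[of k] aa'[of k] that by auto
  have nz: "poly p w \<noteq> 0" if "Im w > 0" for w
    using f(2) pt[OF that] unfolding stable_above_def p[symmetric] by blast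
  have pq: "poly p (z j) = poly q (z j)"
    using zero p[of "z j"] q[of "z j"] by (simp add: one_minus_partial_def)
  have "poly (p - q) w = 0" if w: "Im w > 0" for w
  proof -
    have "poly q w / poly p w = poly q (z j) / poly p (z j)"
    proof (rule halfplane_constant[OF _ _ j _ w])
      show "(\<lambda>w. poly q w / poly p w) holomorphic_on {w. Im w > 0}"
        using nz by (intro holomorphic_intros) auto
      show "Im (poly q w / poly p w) \<le> 0" if "Im w > 0" for w
        using stable_above_Im_log_deriv[OF f pt[OF that], of i] unfolding p q .
      show "Im (poly q (z j) / poly p (z j)) = 0" using pq nz[OF j] by simp
    qed
    then show ?thesis using pq nz[OF j] nz[OF w] by simp
  qed
  \<comment> \<open>Infinitely many zeros force \<open>p = q\<close>, so \<open>w\<close> may be any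
    complex number, in particular a real one.\<close>
  then have "range (\<lambda>n. Complex (of_nat n) 1) \<subseteq> {w. poly (p - q) w = 0}" by auto
  moreover have "infinite (range (\<lambda>n::nat. Complex (of_nat n) 1))"
    by (intro range_inj_infinite injI) simp
  ultimately have "p - q = 0" using poly_roots_finite finite_subset by blast
  then show ?thesis by (simp add: one_minus_partial_def p q)
qed

text \<open>Nonvanishing has to be checked at real points only: a zero with nonreal coordinates can
  be moved, coordinate by coordinate, to a real zero above \<open>a'\<close>.\<close>

lemma stable_above_one_minus_partial:
  assumes f: "poly_fun f" "stable_above f a" and aa': "\<And>k. a k \<le> a' k"
    and real: "\<And>x. (\<And>k. a' k \<le> x k) \<Longrightarrow> one_minus_partial i f (cpt x) \<noteq> 0"
  shows "stable_above (one_minus_partial i f) a'"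
  unfolding stable_above_def
proof (intro allI impI notI)
  fix z
  assume z: "\<forall>k. Im (z k) > 0 \<or> Im (z k) = 0 \<and> a' k \<le> Re (z k)"
    and zero: "one_minus_partial i f z = 0"
  obtain I where I: "finite I"
    "\<And>z z'. (\<And>k. k \<in> I \<Longrightarrow> z k = z' k) \<Longrightarrow> one_minus_partial i f z = one_minus_partial i f z'"
    using poly_fun_finite_support[OF poly_fun_one_minus_partial[OF f(1)]] by metis
  \<comment> \<open>The nonreal coordinates in \<open>J\<close> are moved to the endpoints of their
    rays; \<open>J = I\<close> covers every variable that matters.\<close>
  define r where "r J = (\<lambda>k. if k \<in> J \<and> Im (z k) > 0 then of_real (a' k) else z k)" for J
  have "one_minus_partial i f (r J) = 0" if "finite J" for J
    using that
  proof induction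
    case empty
    then show ?case using zero by (simp add: r_def)
  next
    case (insert j J)
    show ?case
    proof (cases "Im (z j) > 0")
      case True
      have "r (insert j J) = (r J)(j := of_real (a' j))" using True by (auto simp: r_def)
      moreover have "Im (r J j) > 0" using True insert.hyps by (simp add: r_def)
      moreover have "Im (r J k) > 0 \<or> Im (r J k) = 0 \<and> a' k \<le> Re (r J k)" for k
        using z by (simp add: r_def)
      ultimately show ?thesis
        using zero_move_coordinate[OF f aa' _ insert.IH, of j] by (simp only:)
    next
      case False
      then have "r (insert j J) = r J" by (auto simp: r_def)
      then show ?thesis using insert.IH by simp
    qed
  qed
  then have "one_minus_partial i f (r I) = 0" using I(1) .
  moreover have "one_minus_partial i f (r I) =
      one_minus_partial i f (cpt (\<lambda>k. if Im (z k) > 0 then a' k else Re (z k)))"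
    using z by (intro I(2)) (auto simp: r_def complex_eq_iff)
  moreover have "\<dots> \<noteq> 0"
    using z by (intro real) auto
  ultimately show False by simp
qed

lemma stable_above_mono:
  "stable_above f a \<Longrightarrow> (\<And>k. a k \<le> a' k) \<Longrightarrow> stable_above f a'"
  unfolding stable_above_def by (meson order_trans)

text \<open>The log-derivative at a real point. For a real polynomial the quotient is real already,
  so \<open>Re\<close> only changes the type.\<close>

definition barrier :: "nat \<Rightarrow> ((nat \<Rightarrow> complex) \<Rightarrow> complex) \<Rightarrow> (nat \<Rightarrow> real) \<Rightarrow> real" where
  "barrier j f x = Re (partial_deriv j f (cpt x) / f (cpt x))"

section \<open>Behaviour of a barrier along one coordinate\<close>

context
  fixes f :: "(nat \<Rightarrow> complex) \<Rightarrow> complex" and a x :: "nat \<Rightarrow> real" and i j :: nat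
  assumes f: "poly_fun f" "real_fun f" "stable_above f a"
    and x: "\<And>k. a k \<le> x k"
begin

text \<open>Barrier \<open>j\<close> as a function of coordinate \<open>i\<close>, extended to
  complex arguments so that the results on Pick functions apply.\<close>

private definition "G w = partial_deriv j f ((cpt x)(i := w)) / f ((cpt x)(i := w))"

private lemma cpt_upd: "(cpt x)(i := of_real t) = cpt (x(i := t))"
  by auto

private lemma G_of_real: "Re (G (of_real t)) = barrier j f (x(i := t))"
  unfolding G_def cpt_upd by (simp add: barrier_def)

text \<open>Stability covers the upper half-plane and the ray. The lower half-plane follows by
  conjugation, the other coordinates being real.\<close>

private lemma nonzero: "f ((cpt x)(i := w)) \<noteq> 0" if "Im w \<noteq> 0 \<or> a i \<le> Re w"
proof -
  have upper: "f ((cpt x)(i := w)) \<noteq> 0" if "Im w > 0 \<or> Im w = 0 \<and> a i \<le> Re w" for w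
  proof -
    have "\<forall>k. Im (((cpt x)(i := w)) k) > 0 \<or>
        Im (((cpt x)(i := w)) k) = 0 \<and> a k \<le> Re (((cpt x)(i := w)) k)"
      using that x by simp
    then show ?thesis using f(3) unfolding stable_above_def by blast
  qed
  show ?thesis
  proof (cases "Im w \<ge> 0")
    case True
    then show ?thesis using upper[of w] that by (cases "Im w = 0") auto
  next
    case False
    have "(cpt x)(i := cnj w) = (\<lambda>k. cnj (((cpt x)(i := w)) k))" by auto
    then show ?thesis
      using upper[of "cnj w"] False f(2)
      by (metis real_fun_def complex_cnj_zero cnj.sel(2) neg_0_less_iff_less not_le)
  qed
qed

private lemma G_cnj: "G (cnj w) = cnj (G w)"
proof -
  have "(cpt x)(i := cnj w) = (\<lambda>k. cnj (((cpt x)(i := w)) k))" by auto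
  then show ?thesis
    using f(2) real_fun_partial_deriv[OF f(1,2), of j]
    unfolding G_def real_fun_def by (metis complex_cnj_divide)
qed

private lemma G_has_deriv:
  assumes "Im w \<noteq> 0 \<or> a i \<le> Re w"
  shows "(G has_field_derivative
    (partial_deriv i (partial_deriv j f) ((cpt x)(i := w)) * f ((cpt x)(i := w)) -
     partial_deriv j f ((cpt x)(i := w)) * partial_deriv i f ((cpt x)(i := w))) /
     (f ((cpt x)(i := w)) * f ((cpt x)(i := w)))) (at w)"
  unfolding G_def
  by (intro DERIV_divide has_partial_deriv poly_fun_partial_deriv f nonzero assms)

text \<open>Listed in the order of the hypotheses of the \<open>halfplane\<close> lemmas, to be
  passed to them as one bundle.\<close>

private lemma G_halfplane:
  "Im w \<noteq> 0 \<or> a i \<le> Re w \<Longrightarrow> G field_differentiable at w"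
  "Im w > 0 \<Longrightarrow> Im (G w) \<le> 0"
  "Im w < 0 \<Longrightarrow> Im (G w) \<ge> 0"
  "Im (G (of_real t)) = 0"
proof -
  show "Im w \<noteq> 0 \<or> a i \<le> Re w \<Longrightarrow> G field_differentiable at w"
    using G_has_deriv field_differentiable_def by blast
  show up: "Im (G w) \<le> 0" if "Im w > 0" for w
    unfolding G_def using x that by (intro stable_above_Im_log_deriv[OF f(1,3)]) auto
  show "Im (G w) \<ge> 0" if "Im w < 0"
    using up[of "cnj w"] that by (simp add: G_cnj)
  show "Im (G (of_real t)) = 0"
    using arg_cong[OF G_cnj[of "of_real t"], of Im] by simp
qed

lemma barrier_antimono:
  assumes "a i \<le> s" "s \<le> t"
  shows "barrier j f (x(i := t)) \<le> barrier j f (x(i := s))"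
  using halfplane_antimono[OF G_halfplane assms] by (simp add: G_of_real)

text \<open>Write \<Phi> for barriers. Since \<open>f - partial_deriv i f\<close> is
  \<open>f\<close> times 1 - \<Phi>_i, barrier \<open>j\<close> changes by
  \<open>- D / (1 - P)\<close>, where \<open>P\<close> is \<Phi>_i and \<open>D\<close> is the
  \<open>i\<close>-derivative of \<Phi>_j. As \<open>D \<le> 0\<close> and
  \<open>1 / (1 - P) \<le> \<delta>\<close>, this is at most \<open>- \<delta> * D\<close>, which
  the tangent inequality bounds by the gain from moving \<open>x i\<close> back by \<delta>.\<close>

lemma barrier_one_minus_partial:
  assumes \<delta>: "\<delta> > 0" and xi: "a i + \<delta> \<le> x i" and bar: "barrier i f x \<le> 1 - 1 / \<delta>"
  shows "barrier j (one_minus_partial i f) x \<le> barrier j f (x(i := x i - \<delta>))"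
proof -
  define F Fi Fj Fij where "F = f (cpt x)" and "Fi = partial_deriv i f (cpt x)"
    and "Fj = partial_deriv j f (cpt x)" and "Fij = partial_deriv i (partial_deriv j f) (cpt x)"
  note defs = F_def Fi_def Fj_def Fij_def
  have upd: "(cpt x)(i := of_real (x i)) = cpt x" by auto
  have F0: "F \<noteq> 0" using nonzero[of "of_real (x i)"] xi \<delta> x[of i] unfolding upd defs by simp
  have dG: "deriv G (of_real (x i)) = (Fij * F - Fj * Fi) / (F * F)"
    using DERIV_imp_deriv[OF G_has_deriv[of "of_real (x i)"]] x[of i] unfolding upd defs by simp
  have re: "Im F = 0" "Im Fi = 0" "Im Fj = 0" "Im Fij = 0"
    using real_fun_real_point[of f "cpt x"] real_fun_real_point[of "partial_deriv i f" "cpt x"]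
      real_fun_real_point[of "partial_deriv j f" "cpt x"]
      real_fun_real_point[of "partial_deriv i (partial_deriv j f)" "cpt x"] f
    unfolding defs by (simp_all add: real_fun_partial_deriv poly_fun_partial_deriv)
  define r where "r = Re F"
  define ri where "ri = Re Fi"
  define rj where "rj = Re Fj"
  define rij where "rij = Re Fij"
  have eqs: "F = of_real r" "Fi = of_real ri" "Fj = of_real rj" "Fij = of_real rij"
    using re by (simp_all add: complex_eq_iff r_def ri_def rj_def rij_def)
  have r0: "r \<noteq> 0" using F0 eqs by simp
  define D where "D = Re (deriv G (of_real (x i)))"
  have D: "D = (rij * r - rj * ri) / (r * r)"
    unfolding D_def dG eqs by (simp flip: of_real_mult of_real_diff of_real_divide)
  have "D \<le> 0" unfolding D_def using halfplane_deriv_nonpos[OF G_halfplane x[of i]] .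
  have tan: "- (\<delta> * D) \<le> barrier j f (x(i := x i - \<delta>)) - barrier j f x"
    using halfplane_tangent[of "a i" G "x i - \<delta>" "x i"] G_halfplane xi \<delta>
    by (simp add: G_of_real D_def del: of_real_diff)
  have bj: "barrier j f x = rj / r"
    unfolding barrier_def defs[symmetric] eqs by (simp flip: of_real_divide)
  define P where "P = ri / r"
  have "P \<le> 1 - 1 / \<delta>"
    using bar unfolding barrier_def defs[symmetric] eqs P_def by (simp flip: of_real_divide)
  moreover have "1 / \<delta> > 0" using \<delta> by simp
  ultimately have "1 - P > 0" "1 / \<delta> \<le> 1 - P" by linarith+
  then have P: "1 - P > 0" "1 / (1 - P) \<le> \<delta>"
    using \<delta> by (simp_all add: pos_divide_le_eq mult.commute)
  have "barrier j (one_minus_partial i f) x = (rj - rij) / (r - ri)"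
    unfolding barrier_def one_minus_partial_def
      partial_deriv_diff[OF f(1) poly_fun_partial_deriv[OF f(1)]]
      partial_deriv_commute[OF f(1), of j i] defs[symmetric] eqs
    by (simp flip: of_real_diff of_real_divide)
  also have "\<dots> = rj / r - D / (1 - P)"
  proof -
    have "r - ri = r * (1 - P)" using r0 by (simp add: P_def field_simps)
    moreover have "rj - rij = r * (rj / r * (1 - P) - D)"
      using r0 by (simp add: P_def D field_simps)
    ultimately show ?thesis using r0 P(1) by (simp add: diff_divide_distrib)
  qed
  also have "\<dots> \<le> rj / r - \<delta> * D"
    using mult_right_mono[OF P(2), of "- D"] \<open>D \<le> 0\<close> by simp
  also have "\<dots> \<le> barrier j f (x(i := x i - \<delta>))" using tan bj by simp
  finally show ?thesis .
qed

end

text \<open>The bound is uniform on the orthant above \<open>a\<close>, so it is available both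
  where real zeros are excluded and at points shifted back by \<delta>.\<close>

definition barrier_inv ::
  "nat set \<Rightarrow> real \<Rightarrow> ((nat \<Rightarrow> complex) \<Rightarrow> complex) \<Rightarrow> (nat \<Rightarrow> real) \<Rightarrow> bool" where
  "barrier_inv J \<phi> f a \<longleftrightarrow> poly_fun f \<and> real_fun f \<and> stable_above f a \<and>
     (\<forall>j\<in>J. \<forall>x. (\<forall>k. a k \<le> x k) \<longrightarrow> barrier j f x \<le> \<phi>)"

text \<open>A barrier below 1 excludes real zeros of \<open>f - partial_deriv i f\<close>. Raising
  corner \<open>i\<close> by \<delta> pays for the change of all barriers in \<open>J\<close>, so
  the bound stays the same.\<close>

lemma barrier_inv_step:
  assumes inv: "barrier_inv J (1 - 1 / \<delta>) f a" and i: "i \<in> J" and \<delta>: "\<delta> > 0"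
  shows "barrier_inv J (1 - 1 / \<delta>) (one_minus_partial i f) (a(i := a i + \<delta>))"
proof -
  have f: "poly_fun f" "real_fun f" "stable_above f a"
    and bar: "\<And>j x. j \<in> J \<Longrightarrow> (\<And>k. a k \<le> x k) \<Longrightarrow> barrier j f x \<le> 1 - 1 / \<delta>"
    using inv by (auto simp: barrier_inv_def)
  let ?a = "a(i := a i + \<delta>)"
  have le: "a k \<le> ?a k" for k using \<delta> by simp
  have "stable_above (one_minus_partial i f) ?a"
  proof (rule stable_above_one_minus_partial[OF f(1,3) le])
    fix x assume "\<And>k. ?a k \<le> x k"
    then have x: "a k \<le> x k" for k using le order_trans by blast
    have "f (cpt x) \<noteq> 0" using f(3) x by (simp add: stable_above_def)
    moreover have "barrier i f x < 1"
      using bar[OF i x] \<delta> by (smt (verit) zero_less_divide_1_iff)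
    ultimately show "one_minus_partial i f (cpt x) \<noteq> 0"
      by (auto simp: one_minus_partial_def barrier_def)
  qed
  moreover have "barrier j (one_minus_partial i f) x \<le> 1 - 1 / \<delta>"
    if j: "j \<in> J" and ax: "\<And>k. ?a k \<le> x k" for j x
  proof -
    have x: "a k \<le> x k" for k using ax le order_trans by blast
    have xi: "a i + \<delta> \<le> x i" using ax[of i] by simp
    have "barrier j (one_minus_partial i f) x \<le> barrier j f (x(i := x i - \<delta>))"
      by (rule barrier_one_minus_partial[OF f x \<delta> xi bar[OF i x]])
    \<comment> \<open>The point shifted back by \<delta> still lies above the old corner
      \<open>a\<close>.\<close>
    also have "\<dots> \<le> 1 - 1 / \<delta>"
      using x xi by (intro bar[OF j]) auto
    finally show ?thesis .
  qed
  ultimately show ?thesis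
    using f by (simp add: barrier_inv_def poly_fun_one_minus_partial real_fun_one_minus_partial)
qed

text \<open>The indices are distinct, so each coordinate is raised by \<delta> at most once, however
  many operators are applied.\<close>

lemma barrier_inv_foldr:
  assumes "barrier_inv J (1 - 1 / \<delta>) f (\<lambda>_. t)" "\<delta> > 0" "distinct ks" "set ks \<subseteq> J"
  shows "barrier_inv J (1 - 1 / \<delta>) (foldr one_minus_partial ks f)
    (\<lambda>k. if k \<in> set ks then t + \<delta> else t)"
  using assms(3,4)
proof (induction ks)
  case Nil
  then show ?case using assms(1) by simp
next
  case (Cons k ks)
  let ?a = "\<lambda>l. if l \<in> set ks then t + \<delta> else t"
  have "(\<lambda>l. if l \<in> set (k # ks) then t + \<delta> else t) = ?a(k := ?a k + \<delta>)"
    using Cons.prems(1) by auto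
  then show ?case using barrier_inv_step[OF Cons.IH _ assms(2), of k] Cons.prems by simp
qed

text \<open>Lowering coordinates to \<open>t\<close> one at a time never decreases the barrier, and
  only the variables of \<open>f\<close> and its derivative matter.\<close>

lemma barrier_le_diagonal:
  assumes "poly_fun f" "real_fun f" "stable_above f (\<lambda>_. t)" "\<And>k. t \<le> x k"
  shows "barrier j f x \<le> barrier j f (\<lambda>_. t)"
proof -
  obtain I where I: "finite I" "\<And>z z'. (\<And>k. k \<in> I \<Longrightarrow> z k = z' k) \<Longrightarrow> f z = f z'"
    using poly_fun_finite_support[OF assms(1)] by metis
  obtain I' where I': "finite I'"
    "\<And>z z'. (\<And>k. k \<in> I' \<Longrightarrow> z k = z' k) \<Longrightarrow> partial_deriv j f z = partial_deriv j f z'"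
    using poly_fun_finite_support[OF poly_fun_partial_deriv[OF assms(1)]] by metis
  let ?r = "\<lambda>K k. if k \<in> K then t else x k"
  have "barrier j f x \<le> barrier j f (?r K)" if "finite K" for K
    using that
  proof induction
    case (insert k K)
    have "barrier j f ((?r K)(k := x k)) \<le> barrier j f ((?r K)(k := t))"
      using assms by (intro barrier_antimono[where a = "\<lambda>_. t"]) auto
    moreover have "(?r K)(k := x k) = ?r K" "(?r K)(k := t) = ?r (insert k K)"
      using insert.hyps by auto
    ultimately show ?case using insert.IH by simp
  qed simp
  moreover have "barrier j f (?r (I \<union> I')) = barrier j f (\<lambda>_. t)"
  proof -
    have "f (cpt (?r (I \<union> I'))) = f (cpt (\<lambda>_. t))" by (rule I(2)) simp
    moreover have "partial_deriv j f (cpt (?r (I \<union> I'))) = partial_deriv j f (cpt (\<lambda>_. t))"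
      by (rule I'(2)) simp
    ultimately show ?thesis by (simp add: barrier_def)
  qed
  ultimately show ?thesis using I(1) I'(1) by (metis finite_UnI)
qed

section \<open>The determinantal pencil\<close>

lemma cnj_det: "cnj (det M) = det (\<chi> r s. cnj (M $ r $ s))"
  by (simp add: det_def)

lemma quadratic_form_real:
  assumes "hermitian A"
  shows "Im (\<Sum>r\<in>UNIV. cnj (v $ r) * (A *v v) $ r) = 0"
proof -
  have "cnj (\<Sum>r\<in>UNIV. cnj (v $ r) * (A *v v) $ r) =
      (\<Sum>r\<in>UNIV. \<Sum>s\<in>UNIV. v $ r * (cnj (A $ r $ s) * cnj (v $ s)))"
    by (simp add: matrix_vector_mult_def sum_distrib_left)
  also have "\<dots> = (\<Sum>r\<in>UNIV. \<Sum>s\<in>UNIV. cnj (v $ s) * (A $ s $ r * v $ r))"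
    using assms by (intro sum.cong refl) (metis hermitian_def complex_cnj_cnj mult.commute mult.left_commute)
  also have "\<dots> = (\<Sum>s\<in>UNIV. \<Sum>r\<in>UNIV. cnj (v $ s) * (A $ s $ r * v $ r))"
    by (rule sum.swap)
  also have "\<dots> = (\<Sum>r\<in>UNIV. cnj (v $ r) * (A *v v) $ r)"
    by (simp add: matrix_vector_mult_def sum_distrib_left)
  finally show ?thesis by (metis Reals_cnj_iff complex_is_Real_iff)
qed

text \<open>Jacobi's formula at a multiple of the identity, read off the Leibniz expansion, in which
  only the identity permutation contributes.\<close>

lemma has_deriv_det_pencil:
  fixes A :: "complex^'n^'n"
  shows "((\<lambda>w. det (\<chi> r s. (if r = s then t else 0) + (w - t) * A $ r $ s)) has_field_derivative
    t ^ (CARD('n) - 1) * trace A) (at t)"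
proof -
  let ?e = "\<lambda>r s w. (if r = s then t else 0) + (w - t) * A $ r $ s"
  let ?D = "\<lambda>p. \<Sum>x\<in>UNIV. A $ x $ p x * (\<Prod>y\<in>UNIV - {x}. if y = p y then t else 0)"
  have e: "(?e r s has_field_derivative A $ r $ s) (at t)" for r s
    by (auto intro!: derivative_eq_intros)
  have "((\<lambda>w. \<Prod>r\<in>UNIV. ?e r (p r) w) has_field_derivative ?D p) (at t)" for p
    using has_field_derivative_prod[of UNIV "\<lambda>r. ?e r (p r)" "\<lambda>r. A $ r $ p r" t, OF e] by simp
  then have "((\<lambda>w. \<Sum>p | p permutes (UNIV :: 'n set). of_int (sign p) * (\<Prod>r\<in>UNIV. ?e r (p r) w))
      has_field_derivative (\<Sum>p | p permutes (UNIV :: 'n set). of_int (sign p) * ?D p)) (at t)"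
    by (intro DERIV_sum DERIV_cmult)
  moreover have "(\<Sum>p | p permutes (UNIV :: 'n set). of_int (sign p) * ?D p) =
      (\<Sum>p\<in>{id}. of_int (sign p) * ?D p)"
  proof (rule sum.mono_neutral_right)
    show "\<forall>p\<in>{p. p permutes UNIV} - {id}. of_int (sign p) * ?D p = 0"
    proof
      fix p :: "'n \<Rightarrow> 'n" assume p: "p \<in> {p. p permutes UNIV} - {id}"
      then obtain a where a: "p a \<noteq> a" by fastforce
      have inj: "inj p" using p permutes_inj by blast
      \<comment> \<open>Both \<open>a\<close> and \<open>p a\<close> are moved, so a zero factor
        remains whichever factor is differentiated.\<close>
      have pp: "p (p a) \<noteq> p a" using a inj by (metis injD)
      have "(\<Prod>y\<in>UNIV - {x}. if y = p y then t else 0) = 0" for x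
      proof (cases "x = a")
        case True
        then show ?thesis using pp a by (intro prod_zero) (auto intro!: bexI[of _ "p a"])
      next
        case False
        then show ?thesis using a by (intro prod_zero) (auto intro!: bexI[of _ a])
      qed
      then show "of_int (sign p) * ?D p = 0" by (simp only: mult_zero_right sum.neutral_const)
    qed
  qed (auto simp: permutes_id finite_permutations)
  moreover have "\<dots> = t ^ (CARD('n) - 1) * trace A"
    by (simp add: sign_id trace_def sum_distrib_left mult.commute card_Diff_singleton)
  ultimately show ?thesis by (simp add: det_def)
qed

text \<open>Differential operators with constant coefficients commute with translations.\<close>

lemma foldr_one_minus_partial_shift:
  assumes "poly_fun f"
  shows "foldr one_minus_partial ks (\<lambda>x. f (\<lambda>k. x k + z)) =
    (\<lambda>x. foldr one_minus_partial ks f (\<lambda>k. x k + z))"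
proof -
  have pf: "poly_fun (foldr one_minus_partial ks f)" for ks
    by (induction ks) (auto simp: assms poly_fun_one_minus_partial)
  have shift: "one_minus_partial i (\<lambda>x. g (\<lambda>k. x k + z)) = (\<lambda>x. one_minus_partial i g (\<lambda>k. x k + z))"
    if g: "poly_fun g" for g i
  proof -
    have "partial_deriv i (\<lambda>x. g (\<lambda>k. x k + z)) x = partial_deriv i g (\<lambda>k. x k + z)" for x
    proof (rule partial_deriv_eqI)
      have eq: "(\<lambda>k. (x(i := w)) k + z) = (\<lambda>k. x k + z)(i := w + z)" for w by auto
      show "((\<lambda>w. g (\<lambda>k. (x(i := w)) k + z)) has_field_derivative
          partial_deriv i g (\<lambda>k. x k + z)) (at (x i))"
        unfolding eq using has_partial_deriv_at[OF g, of "\<lambda>k. x k + z" i] by (simp add: DERIV_shift)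
    qed
    then show ?thesis by (simp add: one_minus_partial_def)
  qed
  show "foldr one_minus_partial ks (\<lambda>x. f (\<lambda>k. x k + z)) =
      (\<lambda>x. foldr one_minus_partial ks f (\<lambda>k. x k + z))"
    by (induction ks) (simp_all add: shift pf)
qed

section \<open>The pencil of a decomposition of the identity\<close>

context
  fixes m :: nat and A :: "nat \<Rightarrow> complex^'n^'n"
  assumes psd: "\<And>i. i \<in> {1..m} \<Longrightarrow> pos_semidef (A i)"
    and sum_A: "(\<Sum>i=1..m. A i) = mat 1"
begin

text \<open>The matrix in \<open>mixed_char_poly\<close> without \<open>mat z\<close>, which will
  reappear as a shift of the variables.\<close>

private definition "pencil x = (\<Sum>i=1..m. \<chi> r s. x i * A i $ r $ s)"

private lemma pencil_nth: "pencil x $ r $ s = (\<Sum>i=1..m. x i * A i $ r $ s)"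
  by (simp add: pencil_def)

text \<open>The bound \<open>Suc 0\<close> is the simplifier's normal form of 1, so this works as a
  rewrite rule.\<close>

private lemma sum_A_nth: "(\<Sum>i=Suc 0..m. A i $ r $ s) = (if r = s then 1 else 0)"
  using arg_cong[OF sum_A, of "\<lambda>M. M $ r $ s"] by (simp add: mat_def)

private lemma poly_fun_det_pencil: "poly_fun (\<lambda>x. det (pencil x))"
  unfolding det_def pencil_nth by (intro poly_fun_sum poly_fun_prod poly_fun.intros)

text \<open>As the matrices are Hermitian, conjugating the variables takes the pencil to its
  conjugate transpose.\<close>

private lemma real_fun_det_pencil: "real_fun (\<lambda>x. det (pencil x))"
  unfolding real_fun_def
proof
  fix z
  have "pencil (\<lambda>i. cnj (z i)) = transpose (\<chi> r s. cnj (pencil z $ r $ s))"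
  proof -
    have herm: "A i $ r $ s = cnj (A i $ s $ r)" if "i \<in> {1..m}" for i r s
      using psd[OF that] unfolding pos_semidef_def hermitian_def by blast
    have "pencil (\<lambda>i. cnj (z i)) $ r $ s = cnj (pencil z $ s $ r)" for r s
      unfolding pencil_nth cnj_sum complex_cnj_mult
      by (intro sum.cong refl arg_cong[where f = "(*) _"] herm)
    then show ?thesis by (simp add: vec_eq_iff transpose_def)
  qed
  then show "det (pencil (\<lambda>i. cnj (z i))) = cnj (det (pencil z))"
    by (simp add: cnj_det)
qed

text \<open>A kernel vector \<open>v\<close> gives a vanishing sum of \<open>z i * q i\<close> with
  real \<open>q i \<ge> 0\<close>. The imaginary part kills \<open>q i\<close> where
  \<open>z i\<close> is not real, the real part kills the others, and the \<open>q i\<close> add up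
  to the squared norm of \<open>v\<close>.\<close>

private lemma stable_above_det_pencil:
  assumes "t > 0"
  shows "stable_above (\<lambda>x. det (pencil x)) (\<lambda>_. t)"
  unfolding stable_above_def
proof (intro allI impI notI)
  fix z assume z: "\<forall>i. Im (z i) > 0 \<or> Im (z i) = 0 \<and> t \<le> Re (z i)" and "det (pencil z) = 0"
  then obtain v where v: "pencil z *v v = 0" "v \<noteq> 0"
    by (metis invertible_det_nz invertible_left_inverse matrix_left_invertible_ker)
  define q where "q i = (\<Sum>r\<in>UNIV. cnj (v $ r) * (A i *v v) $ r)" for i
  have q: "Im (q i) = 0" "Re (q i) \<ge> 0" if "i \<in> {1..m}" for i
    using psd[OF that] quadratic_form_real by (auto simp: q_def pos_semidef_def)
  \<comment> \<open>This \<open>z\<close> is a fresh variable: the identity serves both at the given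
    zero and at the all-ones point.\<close>
  have "(\<Sum>i=1..m. z i * q i) = (\<Sum>r\<in>UNIV. cnj (v $ r) * (pencil z *v v) $ r)" for z
  proof -
    have "(\<Sum>i=1..m. z i * q i) =
        (\<Sum>i=1..m. \<Sum>r\<in>UNIV. \<Sum>s\<in>UNIV. cnj (v $ r) * (z i * A i $ r $ s * v $ s))"
      by (simp add: q_def matrix_vector_mult_def sum_distrib_left mult_ac)
    also have "\<dots> = (\<Sum>r\<in>UNIV. \<Sum>i=1..m. \<Sum>s\<in>UNIV. cnj (v $ r) * (z i * A i $ r $ s * v $ s))"
      by (rule sum.swap)
    also have "\<dots> = (\<Sum>r\<in>UNIV. \<Sum>s\<in>UNIV. \<Sum>i=1..m. cnj (v $ r) * (z i * A i $ r $ s * v $ s))"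
      by (intro sum.cong refl sum.swap)
    also have "\<dots> = (\<Sum>r\<in>UNIV. cnj (v $ r) * (pencil z *v v) $ r)"
      by (simp add: matrix_vector_mult_def pencil_nth sum_distrib_left sum_distrib_right)
    finally show ?thesis .
  qed
  note form = this
  have zero: "(\<Sum>i=1..m. z i * q i) = 0" unfolding form v(1) by simp
  have zero_Im: "(\<Sum>i=1..m. Im (z i) * Re (q i)) = 0"
    using arg_cong[OF zero, of Im] q by simp
  have "0 \<le> Im (z i) * Re (q i)" if "i \<in> {1..m}" for i
    using z[rule_format, of i] q(2)[OF that] by (intro mult_nonneg_nonneg) auto
  then have Im0: "Im (z i) * Re (q i) = 0" if "i \<in> {1..m}" for i
    using that by (intro sum_nonneg_0[OF _ _ zero_Im]) auto
  have zero_Re: "(\<Sum>i=1..m. Re (z i) * Re (q i)) = 0"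
    using arg_cong[OF zero, of Re] q by simp
  have "0 \<le> Re (z i) * Re (q i)" if "i \<in> {1..m}" for i
  proof (cases "Im (z i) = 0")
    case True
    then show ?thesis
      using z[rule_format, of i] q(2)[OF that] assms by (intro mult_nonneg_nonneg) auto
  next
    case False
    then show ?thesis using Im0[OF that] by simp
  qed
  then have Re0: "Re (z i) * Re (q i) = 0" if "i \<in> {1..m}" for i
    using that by (intro sum_nonneg_0[OF _ _ zero_Re]) auto
  have "q i = 0" if "i \<in> {1..m}" for i
  proof -
    have "Re (q i) = 0"
      using z[rule_format, of i] Im0[OF that] Re0[OF that] assms by auto
    then show ?thesis using q(1)[OF that] by (simp add: complex_eq_iff)
  qed
  \<comment> \<open>At the all-ones point the pencil is the identity, and its form is the squared
    norm of \<open>v\<close>.\<close>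
  then have "(\<Sum>i=1..m. 1 * q i) = 0" by simp
  moreover have "pencil (\<lambda>_. 1) = mat 1"
    by (simp add: vec_eq_iff pencil_nth sum_A_nth mat_def)
  ultimately have "(\<Sum>r\<in>UNIV. cnj (v $ r) * v $ r) = 0"
    using form[of "\<lambda>_. 1"] by simp
  moreover have "(\<Sum>r\<in>UNIV. cnj (v $ r) * v $ r) = of_real (\<Sum>r\<in>UNIV. (cmod (v $ r))\<^sup>2)"
    unfolding of_real_sum complex_norm_square by (simp only: mult.commute)
  ultimately have "complex_of_real (\<Sum>r\<in>UNIV. (cmod (v $ r))\<^sup>2) = 0" by simp
  then have norm0: "(\<Sum>r\<in>UNIV. (cmod (v $ r))\<^sup>2) = 0" by (simp only: of_real_eq_0_iff)
  have "(cmod (v $ r))\<^sup>2 = 0" for r by (rule sum_nonneg_0[OF _ _ norm0]) auto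
  then show False using v(2) by (simp add: vec_eq_iff)
qed

text \<open>On the diagonal the pencil is \<open>t\<close> times the identity, and moving coordinate
  \<open>j\<close> to \<open>w\<close> adds \<open>(w - t)\<close> times \<open>A j\<close>.\<close>

private lemma barrier_det_pencil:
  assumes j: "j \<in> {1..m}" and t: "t > 0"
  shows "barrier j (\<lambda>x. det (pencil x)) (\<lambda>_. t) = Re (trace (A j)) / t"
proof -
  let ?t = "of_real t :: complex"
  have "pencil ((\<lambda>_. ?t)(j := w)) = (\<chi> r s. (if r = s then ?t else 0) + (w - ?t) * A j $ r $ s)" for w
  proof -
    have "(\<Sum>i=1..m. ((\<lambda>_. ?t)(j := w)) i * A i $ r $ s) =
        (\<Sum>i=1..m. ?t * A i $ r $ s + (if i = j then (w - ?t) * A j $ r $ s else 0))" for r s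
      by (intro sum.cong) (auto simp: algebra_simps)
    then show ?thesis
      using j by (simp add: vec_eq_iff pencil_nth sum.distrib sum_A_nth flip: sum_distrib_left)
  qed
  then have "partial_deriv j (\<lambda>x. det (pencil x)) (\<lambda>_. ?t) = ?t ^ (CARD('n) - 1) * trace (A j)"
    using has_deriv_det_pencil[of ?t "A j"] by (intro partial_deriv_eqI) simp
  moreover have "det (pencil (\<lambda>_. ?t)) = ?t ^ CARD('n)"
    by (subst det_diagonal) (auto simp: pencil_nth sum_A_nth simp flip: sum_distrib_left)
  moreover have "?t ^ CARD('n) = ?t ^ (CARD('n) - 1) * ?t"
    by (metis Suc_diff_1 power_Suc2 zero_less_card_finite)
  ultimately show ?thesis
    using t by (simp add: barrier_def)
qed

text \<open>Because the matrices sum to the identity, adding \<open>mat z\<close> shifts every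
  variable by \<open>z\<close>, so evaluation at 0 becomes evaluation on the diagonal.\<close>

private lemma mixed_char_poly_pencil:
  "mixed_char_poly m A z = foldr one_minus_partial [1..<Suc m] (\<lambda>x. det (pencil x)) (\<lambda>_. z)"
proof -
  have "mat z + pencil x = pencil (\<lambda>k. x k + z)" for x
    by (simp add: vec_eq_iff mat_def pencil_nth distrib_right sum.distrib sum_A_nth
        flip: sum_distrib_left)
  then have "mixed_char_poly m A z =
      foldr one_minus_partial [1..<Suc m] (\<lambda>x. det (pencil (\<lambda>k. x k + z))) (\<lambda>_. 0)"
    by (simp add: mixed_char_poly_def pencil_def)
  then show ?thesis
    unfolding foldr_one_minus_partial_shift[OF poly_fun_det_pencil] by simp
qed

lemma mixed_char_poly_eq_stable_diagonal:
  assumes t: "t > 0" and \<delta>: "\<delta> > 0"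
    and tr: "\<And>i. i \<in> {1..m} \<Longrightarrow> Re (trace (A i)) / t \<le> 1 - 1 / \<delta>"
  shows "\<exists>f. real_fun f \<and> stable_above f (\<lambda>_. t + \<delta>) \<and>
    (\<forall>z. mixed_char_poly m A z = f (\<lambda>_. z))"
proof -
  let ?f = "foldr one_minus_partial [1..<Suc m] (\<lambda>x. det (pencil x))"
  have "barrier_inv {1..m} (1 - 1 / \<delta>) (\<lambda>x. det (pencil x)) (\<lambda>_. t)"
    unfolding barrier_inv_def
  proof (intro conjI ballI allI impI)
    fix j and x :: "nat \<Rightarrow> real" assume j: "j \<in> {1..m}" and "\<forall>k. t \<le> x k"
    then have "barrier j (\<lambda>x. det (pencil x)) x \<le> barrier j (\<lambda>x. det (pencil x)) (\<lambda>_. t)"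
      by (intro barrier_le_diagonal poly_fun_det_pencil real_fun_det_pencil stable_above_det_pencil t)
        auto
    also have "\<dots> \<le> 1 - 1 / \<delta>" using tr[OF j] barrier_det_pencil[OF j t] by simp
    finally show "barrier j (\<lambda>x. det (pencil x)) x \<le> 1 - 1 / \<delta>" .
  qed (intro poly_fun_det_pencil real_fun_det_pencil stable_above_det_pencil t)+
  then have "barrier_inv {1..m} (1 - 1 / \<delta>) ?f (\<lambda>k. if k \<in> set [1..<Suc m] then t + \<delta> else t)"
    by (rule barrier_inv_foldr[OF _ \<delta>]) auto
  \<comment> \<open>Indices outside \<open>1..m\<close> still have corner \<open>t\<close>; raising
    them too makes the corner constant.\<close>
  then have "real_fun ?f" "stable_above ?f (\<lambda>_. t + \<delta>)"
    using \<delta> by (auto simp: barrier_inv_def elim!: stable_above_mono)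
  then show ?thesis using mixed_char_poly_pencil by (intro exI[of _ ?f]) simp
qed

end

section \<open>Roots of the mixed characteristic polynomial\<close>

theorem mainTheorem8:
  fixes \<epsilon> :: real and m :: nat and A :: "nat \<Rightarrow> complex^'n^'n"
  assumes "\<epsilon> > 0"
    and "\<And>i. i \<in> {1..m} \<Longrightarrow> pos_semidef (A i)"
    and "(\<Sum>i=1..m. A i) = mat 1"
    and "\<And>i. i \<in> {1..m} \<Longrightarrow> Re (trace (A i)) \<le> \<epsilon>"
  shows "\<forall>z. mixed_char_poly m A z = 0 \<longrightarrow> z \<in> \<real> \<and> Re z \<le> (1 + sqrt \<epsilon>)\<^sup>2"
proof (intro allI impI)
  fix z assume root: "mixed_char_poly m A z = 0"
  \<comment> \<open>Start at \<open>t = s\<^sup>2 + s\<close> and shift by \<open>\<delta> = 1 + s\<close>: then \<open>\<epsilon> / t = 1 - 1 / \<delta>\<close> and \<open>t + \<delta> = (1 + s)\<^sup>2\<close>.\<close>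
  define s where "s = sqrt \<epsilon>"
  have s: "s > 0" "\<epsilon> = s\<^sup>2" using assms(1) by (auto simp: s_def)
  have eps: "\<epsilon> / (s\<^sup>2 + s) = 1 - 1 / (1 + s)"
  proof -
    have "s\<^sup>2 + s = s * (1 + s)" by (simp add: power2_eq_square algebra_simps)
    then have "\<epsilon> / (s\<^sup>2 + s) = s / (1 + s)" using s by (simp add: power2_eq_square)
    also have "\<dots> = 1 - 1 / (1 + s)" using s(1) by (simp add: field_simps)
    finally show ?thesis .
  qed
  have tr: "Re (trace (A i)) / (s\<^sup>2 + s) \<le> 1 - 1 / (1 + s)" if "i \<in> {1..m}" for i
    unfolding eps[symmetric] using s(1) assms(4)[OF that] by (intro divide_right_mono) auto
  have pos: "s\<^sup>2 + s > 0" "1 + s > 0" using s(1) by (auto intro: add_nonneg_pos)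
  obtain f where f: "real_fun f" "stable_above f (\<lambda>_. s\<^sup>2 + s + (1 + s))"
    "\<forall>z. mixed_char_poly m A z = f (\<lambda>_. z)"
    using mixed_char_poly_eq_stable_diagonal[OF assms(2,3) pos tr] by blast
  \<comment> \<open>Stability excludes both \<open>z\<close> and its conjugate from the upper
    half-plane, so \<open>z\<close> is real; being real, it must lie below the corner.\<close>
  have "f (\<lambda>_. z) = 0" "f (\<lambda>_. cnj z) = 0"
    using f(1) root unfolding f(3)[rule_format] by (simp_all add: real_fun_def)
  then have "\<not> (Im z > 0 \<or> Im z = 0 \<and> s\<^sup>2 + s + (1 + s) \<le> Re z)" "\<not> Im (cnj z) > 0"
    using f(2)[unfolded stable_above_def, rule_format, of "\<lambda>_. z"]
      f(2)[unfolded stable_above_def, rule_format, of "\<lambda>_. cnj z"] by auto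
  moreover have "s\<^sup>2 + s + (1 + s) = (1 + s)\<^sup>2" by (simp add: power2_eq_square algebra_simps)
  ultimately show "z \<in> \<real> \<and> Re z \<le> (1 + sqrt \<epsilon>)\<^sup>2"
    by (auto simp: complex_is_Real_iff s_def)
qed

end
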